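(* Let $a<b$ be real numbers and let $r$ be a positive continuous function on the interval $(a,b)$. Then for all measurable functions $f\ge 0$ on $(a,b)$ such that all integrals below exist and are finite, $$\int_a^b r(x)\left(\int_a^x f(t)\,dt\right)^2dx\le (b-a)\,\sup_{a<x<b}\left(\int_x^b r(t)\,dt\right)\int_a^b (f(x))^2\,dx.$$
   Context: Standing assumption: all functions are measurable and all the integrals appearing in the inequality (including $\int_x^b r$ and $\int_a^x f$ for $x\in(a,b)$) exist and are finite. The supremum is taken in $[0,+\infty]$, with $0\cdot\infty=0$. *)

theory Defs
  imports "HOL-Analysis.Analysis"
begin

end

theory Submission
  imports Defs
begin

text \<open>
  By Cauchy--Schwarz, \<open>(\<integral>\<^sub>a\<^sup>x f)\<^sup>2 \<le> (x - a) \<integral>\<^sub>a\<^sup>x f\<^sup>2 \<le> (b - a) \<integral>\<^sub>a\<^sup>x f\<^sup>2\<close>. Multiplying by \<open>r\<close>,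
  integrating and exchanging the order of integration turns the left-hand side into at most
  \<open>(b - a) \<integral> f(t)\<^sup>2 (\<integral>\<^sub>t\<^sup>b r) dt\<close>, and the inner integral is bounded by its supremum.
\<close>

text \<open>Cauchy-Schwarz for the pair \<open>f\<close> and the constant 1. The right-hand side
  lives in \<open>ennreal\<close>, so the bound still has a meaning if the measure or the integral
  of the square is infinite.\<close>

lemma square_integral_le_nn_integral_square:
  fixes f :: "'a \<Rightarrow> real"
  assumes f: "integrable M f" and nonneg: "\<And>x. x \<in> space M \<Longrightarrow> 0 \<le> f x"
  shows "ennreal ((LINT x|M. f x)\<^sup>2) \<le> emeasure M (space M) * (\<integral>\<^sup>+x. ennreal ((f x)\<^sup>2) \<partial>M)"
proof -
  have [measurable]: "f \<in> borel_measurable M"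
    using f by auto
  have "ennreal ((LINT x|M. f x)\<^sup>2) = (\<integral>\<^sup>+x. ennreal (f x) * 1 \<partial>M)\<^sup>2"
    using f nonneg by (simp add: nn_integral_eq_integral ennreal_power integral_nonneg_AE)
  also have "\<dots> \<le> (\<integral>\<^sup>+x. (ennreal (f x))\<^sup>2 \<partial>M) * (\<integral>\<^sup>+x. 1\<^sup>2 \<partial>M)"
    by (rule Cauchy_Schwarz_nn_integral) auto
  also have "(\<integral>\<^sup>+x. (ennreal (f x))\<^sup>2 \<partial>M) = (\<integral>\<^sup>+x. ennreal ((f x)\<^sup>2) \<partial>M)"
    by (rule nn_integral_cong) (simp add: nonneg ennreal_power)
  finally show ?thesis
    by (simp add: mult.commute)
qed

text \<open>Serves to move integrals over \<open>{a<..<x}\<close> and \<open>{t<..<b}\<close> to the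
  one measure on \<open>{a<..<b}\<close>, where the order of integration can be exchanged.\<close>

lemma nn_integral_lebesgue_on_subset:
  assumes "S \<subseteq> T" "S \<in> sets lebesgue" "T \<in> sets lebesgue"
  shows "(\<integral>\<^sup>+x. g x \<partial>lebesgue_on S) = (\<integral>\<^sup>+x. g x * indicator S x \<partial>lebesgue_on T)"
proof -
  have "lebesgue_on S = restrict_space (lebesgue_on T) S"
    using assms by (simp add: restrict_restrict_space Int_absorb1)
  moreover have "S \<inter> space (lebesgue_on T) \<in> sets (lebesgue_on T)"
    using assms by (auto simp: sets_restrict_space)
  ultimately show ?thesis
    by (simp add: nn_integral_restrict_space)
qed

theorem theorem2p3:
  fixes a b :: real and r f :: "real \<Rightarrow> real"
  assumes "a < b"
    and "continuous_on {a<..<b} r"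
    and "\<And>x. x \<in> {a<..<b} \<Longrightarrow> 0 < r x"
    and "f \<in> borel_measurable (lebesgue_on {a<..<b})"
    and "\<And>x. x \<in> {a<..<b} \<Longrightarrow> 0 \<le> f x"
    and "\<And>x. x \<in> {a<..<b} \<Longrightarrow> integrable (lebesgue_on {a<..<x}) f"
    and "\<And>x. x \<in> {a<..<b} \<Longrightarrow> integrable (lebesgue_on {x<..<b}) r"
    and "integrable (lebesgue_on {a<..<b}) (\<lambda>x. r x * (LINT t|lebesgue_on {a<..<x}. f t)\<^sup>2)"
    and "integrable (lebesgue_on {a<..<b}) (\<lambda>x. (f x)\<^sup>2)"
  shows "ennreal (LINT x|lebesgue_on {a<..<b}. r x * (LINT t|lebesgue_on {a<..<x}. f t)\<^sup>2)
    \<le> ennreal (b - a)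
        * (SUP x\<in>{a<..<b}. ennreal (LINT t|lebesgue_on {x<..<b}. r t))
        * ennreal (LINT x|lebesgue_on {a<..<b}. (f x)\<^sup>2)"
proof -
  define M where "M = lebesgue_on {a<..<b}"
  define F where "F x = (LINT t|lebesgue_on {a<..<x}. f t)" for x
  \<comment> \<open>The \<open>if\<close> cuts out the triangle a < t < x < b, turning both variable
    limits of integration into a factor of the integrand.\<close>
  define K where "K x t = ennreal (b - a) * ennreal (r x) * ennreal ((f t)\<^sup>2) * (if t < x then 1 else 0)"
    for x t
  define S where "S = (SUP x\<in>{a<..<b}. ennreal (LINT t|lebesgue_on {x<..<b}. r t))"
  have space_M: "space M = {a<..<b}"
    by (simp add: M_def)
  \<comment> \<open>Finiteness supplies the sigma-finiteness required for Fubini.\<close>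
  interpret M: finite_measure M
    unfolding M_def by (rule finite_measure_lebesgue_on) auto
  interpret MM: pair_sigma_finite M M ..
  have [measurable]: "f \<in> borel_measurable M" "r \<in> borel_measurable M"
    using assms by (auto simp: M_def intro: continuous_imp_measurable_on_sets_lebesgue)
  \<comment> \<open>Makes the set t < x measurable in the product of \<open>M\<close> with itself,
    hence \<open>K\<close> jointly measurable.\<close>
  have [measurable]: "(\<lambda>x. x) \<in> borel_measurable M"
    by (auto simp: M_def intro: continuous_imp_measurable_on_sets_lebesgue)

  \<comment> \<open>For fixed x the section of the triangle is \<open>{a<..<x}\<close>; enlarging
    its length to b - a makes the constant independent of x.\<close>
  have inner: "ennreal (r x * (F x)\<^sup>2) \<le> (\<integral>\<^sup>+t. K x t \<partial>M)" if x: "x \<in> {a<..<b}" for x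
  proof -
    have "ennreal ((F x)\<^sup>2)
        \<le> emeasure (lebesgue_on {a<..<x}) {a<..<x} * (\<integral>\<^sup>+t. ennreal ((f t)\<^sup>2) \<partial>lebesgue_on {a<..<x})"
      using square_integral_le_nn_integral_square[OF assms(6)[OF x]] x assms(5)
      by (simp add: F_def)
    also have "\<dots> \<le> ennreal (b - a) * (\<integral>\<^sup>+t. ennreal ((f t)\<^sup>2) \<partial>lebesgue_on {a<..<x})"
      using x by (intro mult_right_mono) (auto simp: emeasure_restrict_space intro!: ennreal_leI)
    also have "(\<integral>\<^sup>+t. ennreal ((f t)\<^sup>2) \<partial>lebesgue_on {a<..<x})
        = (\<integral>\<^sup>+t. ennreal ((f t)\<^sup>2) * indicator {a<..<x} t \<partial>M)"
      unfolding M_def using x by (intro nn_integral_lebesgue_on_subset) auto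
    also have "\<dots> = (\<integral>\<^sup>+t. ennreal ((f t)\<^sup>2) * (if t < x then 1 else 0) \<partial>M)"
      by (rule nn_integral_cong) (auto simp: space_M)
    finally have "ennreal (r x) * ennreal ((F x)\<^sup>2) \<le> ennreal (r x) *
        (ennreal (b - a) * (\<integral>\<^sup>+t. ennreal ((f t)\<^sup>2) * (if t < x then 1 else 0) \<partial>M))"
      by (rule mult_left_mono) simp
    also have "\<dots> = (\<integral>\<^sup>+t. K x t \<partial>M)"
      unfolding K_def by (simp add: nn_integral_cmult[symmetric] mult_ac del: mult_if_delta)
    finally show ?thesis
      using assms(3)[OF x] by (simp add: ennreal_mult)
  qed

  have outer: "(\<integral>\<^sup>+x. K x t \<partial>M) \<le> ennreal (b - a) * S * ennreal ((f t)\<^sup>2)" if t: "t \<in> {a<..<b}" for t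
  proof -
    have "(\<integral>\<^sup>+x. ennreal (r x) * (if t < x then 1 else 0) \<partial>M)
        = (\<integral>\<^sup>+x. ennreal (r x) * indicator {t<..<b} x \<partial>M)"
      by (rule nn_integral_cong) (auto simp: space_M)
    also have "\<dots> = (\<integral>\<^sup>+x. ennreal (r x) \<partial>lebesgue_on {t<..<b})"
      unfolding M_def using t by (intro nn_integral_lebesgue_on_subset[symmetric]) auto
    \<comment> \<open>Integrability of \<open>r\<close> on the tail matters here: a
      \<open>LINT\<close> of a non-integrable function is 0 by default and would not bound the
      tail.\<close>
    also have "\<dots> = ennreal (LINT x|lebesgue_on {t<..<b}. r x)"
      using assms(7)[OF t] t by (intro nn_integral_eq_integral) (auto simp: less_imp_le assms(3))
    also have "\<dots> \<le> S"
      unfolding S_def using t by (intro SUP_upper)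
    finally have "ennreal (b - a) * ennreal ((f t)\<^sup>2) *
        (\<integral>\<^sup>+x. ennreal (r x) * (if t < x then 1 else 0) \<partial>M) \<le> ennreal (b - a) * ennreal ((f t)\<^sup>2) * S"
      by (rule mult_left_mono) simp
    then show ?thesis
      unfolding K_def by (simp add: nn_integral_cmult[symmetric] mult_ac)
  qed

  have "ennreal (LINT x|M. r x * (F x)\<^sup>2) = (\<integral>\<^sup>+x. ennreal (r x * (F x)\<^sup>2) \<partial>M)"
    using assms(8) by (intro nn_integral_eq_integral[symmetric])
      (auto simp: M_def F_def less_imp_le assms(3))
  also have "\<dots> \<le> (\<integral>\<^sup>+x. (\<integral>\<^sup>+t. K x t \<partial>M) \<partial>M)"
    by (intro nn_integral_mono inner) (simp add: space_M)
  \<comment> \<open>Tonelli: \<open>K\<close> takes values in \<open>ennreal\<close>, so joint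
    measurability suffices.\<close>
  also have "\<dots> = (\<integral>\<^sup>+t. (\<integral>\<^sup>+x. K x t \<partial>M) \<partial>M)"
    by (rule MM.Fubini'[symmetric]) (unfold K_def, measurable)
  also have "\<dots> \<le> (\<integral>\<^sup>+t. ennreal (b - a) * S * ennreal ((f t)\<^sup>2) \<partial>M)"
    by (intro nn_integral_mono outer) (simp add: space_M)
  \<comment> \<open>The constant may be pulled out even if \<open>S\<close> is infinite, since in
    \<open>ennreal\<close> the product of 0 and infinity is 0.\<close>
  also have "\<dots> = ennreal (b - a) * S * (\<integral>\<^sup>+t. ennreal ((f t)\<^sup>2) \<partial>M)"
    by (intro nn_integral_cmult) measurable
  also have "(\<integral>\<^sup>+t. ennreal ((f t)\<^sup>2) \<partial>M) = ennreal (LINT t|M. (f t)\<^sup>2)"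
    using assms(9) by (intro nn_integral_eq_integral) (auto simp: M_def)
  finally show ?thesis
    by (simp add: M_def F_def S_def)
qed

end
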